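(* Let $f=f_1+f_2$ on $\mathbb{R}^m$ and $g=g_1+g_2$ on $\mathbb{R}^n$, where $f_1:\mathbb{R}^m\to\mathbb{R}\cup\{+\infty\}$ is proper, closed and convex; $f_2:\mathbb{R}^m\to\mathbb{R}$ is convex with $L_{f_2}$-Lipschitz continuous gradient; $g_1:\mathbb{R}^n\to\mathbb{R}\cup\{+\infty\}$ is proper, closed and $\mu_g$-strongly convex ($\mu_g>0$); $g_2:\mathbb{R}^n\to\mathbb{R}$ is convex with $L_{g_2}$-Lipschitz continuous gradient. Let $A\in\mathbb{R}^{p\times m}$, $B\in\mathbb{R}^{p\times n}$, $b\in\mathbb{R}^p$, let $\mathcal{L}(x,y,\lambda)=f(x)+g(y)+\langle\lambda,Ax+By-b\rangle$, and suppose its set of saddle points $\Omega$ is nonempty. Let $\{(x_k,y_k)\}_{k\ge1}$ be generated by Algorithm 6 (described in the context) with parameters $\alpha,\beta,\gamma>0$, and let $(x^*,y^*,\lambda^* )\in\Omega$. Assume $\alpha\le \frac{1}{L_{f_2}}$, $\beta\le\frac{t_1^2}{L_{g_2}+t_1^2\gamma\|B\|^2}$, and that $\{t_k\}_{k\ge1}\subseteq[1,+\infty)$ is a nondecreasing sequence satisfying, for all $k\ge1$, $$t_{k+1}^2\le t_k^2+t_{k+1}\quad\text{and}\quad t_{k+1}^2\le t_k^2+\beta\mu_g t_k .$$ Then for all $k\ge1$: $$\mathcal{L}(x_k,y_k,\lambda^* )-\mathcal{L}(x^*,y^*,\lambda^* )\le\frac{\mathcal{E}_1}{t_k^2},\qquad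 \|Ax_k+By_k-b\|\le\frac{C_2}{t_k^2},$$ $$|f(x_k)+g(y_k)-f(x^* )-g(y^* )|\le\frac{\mathcal{E}_1+C_2\|\lambda^*\|}{t_k^2},$$ where $$\mathcal{E}_1=t_1^2\big(\mathcal{L}(x_1,y_1,\lambda^* )-\mathcal{L}(x^*,y^*,\lambda^* )\big)+\frac{1}{2\alpha}\|x_1-x^*\|^2+\frac{t_2^2}{2\beta}\|y_1-y^*\|^2+\frac{1}{2\gamma}\|\lambda_1-\lambda^*\|^2,$$ $$C_2=3t_1^2\|Ax_1+By_1-b\|+\frac{2\|\lambda_1-\lambda^*\|+2\sqrt{2\gamma\mathcal{E}_1}}{\gamma}.$$
   Context: Norms are Euclidean (operator norm for matrices). $dom(F)=\{x: F(x)<+\infty\}$; $F$ is proper if $dom(F)\ne\emptyset$; $F$ is closed if $F(x)\le\liminf_{y\to x}F(y)$ for all $x$ and $dom(F)$ is closed. $1/0$ is read as $+\infty$ in step-size bounds. $\mu_g$-strong convexity of $g_1$ means $g_1(y_2)-g_1(y_1)-\langle\xi,y_2-y_1\rangle\ge\frac{\mu_g}{2}\|y_2-y_1\|^2$ for all $y_1,y_2$ and $\xi\in\partial g_1(y_1)$. A saddle point is a triple $(x^*,y^*,\lambda^* )$ with $\mathcal{L}(x^*,y^*,\lambda)\le\mathcal{L}(x^*,y^*,\lambda^* )\le\mathcal{L}(x,y,\lambda^* )$ for all $(x,y,\lambda)$. The proximal operator is $\mathbf{Prox}_{s,h}(z)=\arg\min_x h(x)+\frac{1}{2s}\|x-z\|^2$.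 Algorithm 6 (for $\min f(x)+g(y)$ s.t. $Ax+By=b$). Initialize $x_1=x_0=u_1\in dom(f)$, $y_1=y_0=v_1\in dom(g)$, $\lambda_1\in\mathbb{R}^p$. For $k=1,2,\dots$: - $(\bar x_k,\bar y_k)=(x_k,y_k)+\frac{t_k-1}{t_{k+1}}[(x_k,y_k)-(x_{k-1},y_{k-1})]$; - $u_{k+1}=\arg\min_u\big(f_1(u)+\langle A^T\lambda_k+\nabla f_2(\bar x_k),u\rangle+\frac{\gamma t_{k+1}}{2}\|Au+Bv_k-b\|^2+\frac{1}{2\alpha t_{k+1}}\|u-u_k\|^2\big)$; - $\bar\lambda_{k+1}=\lambda_k+\gamma t_{k+1}(Au_{k+1}+Bv_k-b)$; - $v_{k+1}=\mathbf{Prox}_{\frac{\beta}{t_{k+1}},g_1}\big(v_k-\frac{\beta}{t_{k+1}}(B^T\bar\lambda_{k+1}+\nabla g_2(\bar y_k))\big)$; - $(x_{k+1},y_{k+1})=\frac{1}{t_{k+1}}(u_{k+1},v_{k+1})+\frac{t_{k+1}-1}{t_{k+1}}(x_k,y_k)$; - $\lambda_{k+1}=\lambda_k+\gamma t_{k+1}(Au_{k+1}+Bv_{k+1}-b)$. *)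

theory Defs
  imports "HOL-Analysis.Analysis"
begin

text \<open>
  Functions with values in the reals extended by plus infinity are functions into \<^typ>\<open>ereal\<close>
  that never take the value minus infinity; the latter is always assumed separately.
\<close>

definition edom :: "('a \<Rightarrow> ereal) \<Rightarrow> 'a set" where
  "edom F = {x. F x < \<infinity>}"

definition proper_fun :: "('a \<Rightarrow> ereal) \<Rightarrow> bool" where
  "proper_fun F \<longleftrightarrow> edom F \<noteq> {}"

text \<open>
  Closedness means lower semicontinuity together with a closed domain. The limit inferior is
  over the punctured neighbourhoods of \<open>x\<close>, which gives the same notion.
\<close>

definition closed_fun :: "('a::topological_space \<Rightarrow> ereal) \<Rightarrow> bool" where
  "closed_fun F \<longleftrightarrow> (\<forall>x. F x \<le> Liminf (at x) F) \<and> closed (edom F)"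

text \<open>
  The convention \<open>0 * \<infinity> = 0\<close> of \<^typ>\<open>ereal\<close> makes the inequality trivial for \<open>s = 0\<close> and \<open>s = 1\<close>.
\<close>

definition convex_fun :: "('a::real_vector \<Rightarrow> ereal) \<Rightarrow> bool" where
  "convex_fun F \<longleftrightarrow>
     (\<forall>x y. \<forall>s\<in>{0..1}. F ((1 - s) *\<^sub>R x + s *\<^sub>R y) \<le> ereal (1 - s) * F x + ereal s * F y)"

definition subdifferential :: "('a::real_inner \<Rightarrow> ereal) \<Rightarrow> 'a \<Rightarrow> 'a set" where
  "subdifferential F x = {\<xi>. F x < \<infinity> \<and> (\<forall>z. F x + ereal (\<xi> \<bullet> (z - x)) \<le> F z)}"

text \<open>
  Convexity is demanded explicitly: the inequality alone says nothing at points without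
  subgradients.
\<close>

definition strongly_convex_fun :: "real \<Rightarrow> ('a::real_inner \<Rightarrow> ereal) \<Rightarrow> bool" where
  "strongly_convex_fun \<mu> F \<longleftrightarrow> convex_fun F \<and>
     (\<forall>y1 y2. \<forall>\<xi>\<in>subdifferential F y1.
        F y2 - F y1 - ereal (\<xi> \<bullet> (y2 - y1)) \<ge> ereal (\<mu> / 2 * (norm (y2 - y1))\<^sup>2))"

definition lagrangian ::
  "(real^'m \<Rightarrow> ereal) \<Rightarrow> (real^'n \<Rightarrow> ereal) \<Rightarrow> real^'m^'p \<Rightarrow> real^'n^'p \<Rightarrow> real^'p \<Rightarrow>
   real^'m \<Rightarrow> real^'n \<Rightarrow> real^'p \<Rightarrow> ereal" where
  "lagrangian f g A B b x y l = f x + g y + ereal (l \<bullet> (A *v x + B *v y - b))"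

definition saddle_points :: "('a \<Rightarrow> 'b \<Rightarrow> 'c \<Rightarrow> ereal) \<Rightarrow> ('a \<times> 'b \<times> 'c) set" where
  "saddle_points L = {(xs, ys, ls).
     \<forall>x y l. L xs ys l \<le> L xs ys ls \<and> L xs ys ls \<le> L x y ls}"

definition is_argmin :: "('a \<Rightarrow> ereal) \<Rightarrow> 'a \<Rightarrow> bool" where
  "is_argmin F x \<longleftrightarrow> is_arg_min F (\<lambda>_. True) x"

text \<open>\<open>is_prox s h z w\<close> expresses \<open>w = Prox\<^bsub>s,h\<^esub>(z)\<close>.\<close>

definition is_prox :: "real \<Rightarrow> ('a::real_normed_vector \<Rightarrow> ereal) \<Rightarrow> 'a \<Rightarrow> 'a \<Rightarrow> bool" where
  "is_prox s h z w \<longleftrightarrow> is_argmin (\<lambda>x. h x + ereal (1 / (2 * s) * (norm (x - z))\<^sup>2)) w"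

text \<open>
  The arguments \<open>df2\<close> and \<open>dg2\<close> stand for the gradients of the smooth parts. Index \<open>0\<close> is used
  only for \<open>x\<close> and \<open>y\<close>; the values of \<open>t\<close>, \<open>u\<close>, \<open>v\<close> and \<open>\<Lambda>\<close> (the multipliers) at \<open>0\<close> are irrelevant.
\<close>

definition accelerated_iterates ::
  "(real^'m \<Rightarrow> ereal) \<Rightarrow> (real^'m \<Rightarrow> ereal) \<Rightarrow> (real^'m \<Rightarrow> real^'m) \<Rightarrow>
   (real^'n \<Rightarrow> ereal) \<Rightarrow> (real^'n \<Rightarrow> ereal) \<Rightarrow> (real^'n \<Rightarrow> real^'n) \<Rightarrow>
   real^'m^'p \<Rightarrow> real^'n^'p \<Rightarrow> real^'p \<Rightarrow> real \<Rightarrow> real \<Rightarrow> real \<Rightarrow> (nat \<Rightarrow> real) \<Rightarrow>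
   (nat \<Rightarrow> real^'m) \<Rightarrow> (nat \<Rightarrow> real^'n) \<Rightarrow> (nat \<Rightarrow> real^'m) \<Rightarrow> (nat \<Rightarrow> real^'n) \<Rightarrow>
   (nat \<Rightarrow> real^'p) \<Rightarrow> bool" where
  "accelerated_iterates f f1 df2 g g1 dg2 A B b \<alpha> \<beta> \<gamma> t x y u v \<Lambda> \<longleftrightarrow>
     x 1 = x 0 \<and> u 1 = x 1 \<and> x 1 \<in> edom f \<and>
     y 1 = y 0 \<and> v 1 = y 1 \<and> y 1 \<in> edom g \<and>
     (\<forall>k\<ge>1.
        let \<tau> = t (k + 1);
            xbar = x k + ((t k - 1) / \<tau>) *\<^sub>R (x k - x (k - 1));
            ybar = y k + ((t k - 1) / \<tau>) *\<^sub>R (y k - y (k - 1));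
            lbar = \<Lambda> k + (\<gamma> * \<tau>) *\<^sub>R (A *v u (k + 1) + B *v v k - b)
        in
          is_argmin
            (\<lambda>w. f1 w + ereal ((transpose A *v \<Lambda> k + df2 xbar) \<bullet> w
                  + \<gamma> * \<tau> / 2 * (norm (A *v w + B *v v k - b))\<^sup>2
                  + 1 / (2 * \<alpha> * \<tau>) * (norm (w - u k))\<^sup>2))
            (u (k + 1)) \<and>
          is_prox (\<beta> / \<tau>) g1
            (v k - (\<beta> / \<tau>) *\<^sub>R (transpose B *v lbar + dg2 ybar)) (v (k + 1)) \<and>
          x (k + 1) = (1 / \<tau>) *\<^sub>R u (k + 1) + ((\<tau> - 1) / \<tau>) *\<^sub>R x k \<and>
          y (k + 1) = (1 / \<tau>) *\<^sub>R v (k + 1) + ((\<tau> - 1) / \<tau>) *\<^sub>R y k \<and>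
          \<Lambda> (k + 1) = \<Lambda> k + (\<gamma> * \<tau>) *\<^sub>R (A *v u (k + 1) + B *v v (k + 1) - b))"

text \<open>\<^const>\<open>norm\<close> on matrices is the Frobenius norm; the operator norm is needed here.\<close>

definition matrix_opnorm :: "real^'n^'p \<Rightarrow> real" where
  "matrix_opnorm M = onorm ((*v) M)"

end

theory Submission
  imports Defs
begin

text \<open>
  Along the iteration, the energy
  \[ t_k^2 (L(x_k,y_k,\lambda^*) - L^*) + \tfrac{1}{2\alpha} \|u_k - x^*\|^2
     + \tfrac{t_{k+1}^2}{2\beta} \|v_k - y^*\|^2 + \tfrac{1}{2\gamma} \|\lambda_k - \lambda^*\|^2 \]
  does not increase. For the two primal blocks this is the usual accelerated proximal gradient
  estimate; strong convexity of \<open>g\<^sub>1\<close> pays for the growth of the weight \<open>t\<^sub>k\<^sub>+\<^sub>1\<^sup>2\<close>. Since the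
  predicted multiplier differs from \<open>\<lambda>\<^sub>k\<^sub>+\<^sub>1\<close> by a multiple of \<open>B (v\<^sub>k\<^sub>+\<^sub>1 - v\<^sub>k)\<close>, the three-point
  identity for the multipliers leaves an error quadratic in \<open>v\<^sub>k\<^sub>+\<^sub>1 - v\<^sub>k\<close>, which the bound on
  \<open>\<beta>\<close> absorbs. The energy bound makes the multipliers bounded, and their increments are a weighted
  telescoping sum of the residuals \<open>s\<^sub>k = t\<^sub>k\<^sup>2 (A x\<^sub>k + B y\<^sub>k - b)\<close>: the vectors
  \<open>s\<^sub>k + \<Sum>\<^sub>j\<^sub><\<^sub>k c\<^sub>j s\<^sub>j\<close> are bounded, with \<open>c\<^sub>j\<close> in \<open>[0, 1]\<close>, which bounds \<open>s\<^sub>k\<close> itself.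
\<close>

text \<open>Compare \<open>p\<close> with nearby points of the segment to \<open>z\<close>.
  Minimality and convexity bound the difference quotient of \<open>q\<close> below by
  \<open>a - c\<close>, and the limit \<open>s\<close> to 0 from the right gives the subgradient
  inequality.\<close>

lemma argmin_gradient_in_subdifferential:
  fixes h :: "'a::real_inner \<Rightarrow> ereal"
  assumes h: "convex_fun h" "\<And>z. h z \<noteq> -\<infinity>" "proper_fun h"
    and q: "GDERIV q p :> G"
    and min: "is_argmin (\<lambda>w. h w + ereal (q w)) p"
  shows "- G \<in> subdifferential h p"
proof -
  have le: "h p + ereal (q p) \<le> h w + ereal (q w)" for w
    using min unfolding is_argmin_def is_arg_min_def by (meson linorder_not_less)
  obtain w0 where "h w0 < \<infinity>"
    using h(3) by (auto simp: proper_fun_def edom_def)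
  then have "h p + ereal (q p) < \<infinity>"
    using le[of w0] h(2)[of w0] by (cases "h w0") auto
  then have "h p < \<infinity>" by (cases "h p") auto
  then obtain a where a: "h p = ereal a" using h(2)[of p] by (cases "h p") auto
  have "h p + ereal (- G \<bullet> (z - p)) \<le> h z" for z
  proof (cases "h z")
    case (real c)
    define d where "d = z - p"
    have lim: "((\<lambda>s. (q (p + s *\<^sub>R d) - q p) / s) \<longlongrightarrow> G \<bullet> d) (at_right 0)"
    proof -
      have "((\<lambda>s. p + s *\<^sub>R d) has_derivative (\<lambda>s. s *\<^sub>R d)) (at (0::real))"
        by (auto intro!: derivative_eq_intros)
      moreover have "(q has_derivative (\<lambda>e. G \<bullet> e)) (at (p + 0 *\<^sub>R d))"
        using q by (simp add: gderiv_def inner_commute)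
      ultimately have "((\<lambda>s. q (p + s *\<^sub>R d)) has_derivative (\<lambda>s. G \<bullet> (s *\<^sub>R d))) (at (0::real))"
        by (rule has_derivative_compose)
      then have "((\<lambda>s. q (p + s *\<^sub>R d)) has_real_derivative (G \<bullet> d)) (at 0)"
        by (simp add: has_field_derivative_def mult.commute[of _ "G \<bullet> d"] mult_commute_abs)
      then show ?thesis
        by (auto simp: DERIV_def intro: filterlim_at_withinI filterlim_mono at_le)
    qed
    have "eventually (\<lambda>s. a - c \<le> (q (p + s *\<^sub>R d) - q p) / s) (at_right 0)"
      unfolding eventually_at_right_field
    proof (intro exI[of _ 1] conjI allI impI)
      fix s :: real assume s: "0 < s" "s < 1"
      have eq: "(1 - s) *\<^sub>R p + s *\<^sub>R z = p + s *\<^sub>R d"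
        by (simp add: d_def algebra_simps)
      have "h ((1 - s) *\<^sub>R p + s *\<^sub>R z) \<le> ereal (1 - s) * h p + ereal s * h z"
        using h(1) s by (auto simp: convex_fun_def)
      then have "h (p + s *\<^sub>R d) \<le> ereal ((1 - s) * a + s * c)"
        unfolding eq by (simp add: a real)
      then have "ereal (a + q p) \<le> ereal ((1 - s) * a + s * c + q (p + s *\<^sub>R d))"
        using order_trans[OF le[of "p + s *\<^sub>R d"] add_right_mono] by (fastforce simp: a)
      then have "s * (a - c) \<le> q (p + s *\<^sub>R d) - q p"
        by (simp add: algebra_simps)
      then show "a - c \<le> (q (p + s *\<^sub>R d) - q p) / s"
        using s by (simp add: field_simps)
    qed simp
    then have "a - c \<le> G \<bullet> d"
      by (intro tendsto_lowerbound[OF lim]) auto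
    then show ?thesis by (simp add: a real d_def)
  qed (use h(2) in auto)
  then show ?thesis using \<open>h p < \<infinity>\<close> by (auto simp: subdifferential_def)
qed

lemma convex_gradient_inequality:
  fixes f :: "'a::real_inner \<Rightarrow> real"
  assumes "convex_on UNIV f" "GDERIV f p :> G"
  shows "f p + G \<bullet> (z - p) \<le> f z"
proof -
  \<comment> \<open>Every point minimises \<open>f + (- f)\<close>.\<close>
  have "- (- G) \<in> subdifferential (\<lambda>w. ereal (f w)) p"
  proof (rule argmin_gradient_in_subdifferential)
    show "GDERIV (\<lambda>w. - f w) p :> - G"
      using assms(2) by (rule GDERIV_minus)
    show "convex_fun (\<lambda>w. ereal (f w))"
      using assms(1) by (auto simp: convex_fun_def convex_on_def)
    show "is_argmin (\<lambda>w. ereal (f w) + ereal (- f w)) p"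
      by (simp add: is_argmin_def is_arg_min_def)
  qed (auto simp: proper_fun_def edom_def)
  then show ?thesis by (simp add: subdifferential_def)
qed

text \<open>The descent lemma. Its defect \<open>\<phi>\<close> along the segment from
  \<open>p\<close> to \<open>z\<close> is nonincreasing, since Cauchy-Schwarz and the Lipschitz
  bound control the change of the gradient.\<close>

lemma lipschitz_gradient_upper_bound:
  fixes f :: "'a::real_inner \<Rightarrow> real"
  assumes df: "\<And>z. GDERIV f z :> df z" and lip: "K-lipschitz_on UNIV df"
  shows "f z \<le> f p + df p \<bullet> (z - p) + K / 2 * (norm (z - p))\<^sup>2"
proof -
  define d where "d = z - p"
  define \<phi> where "\<phi> s = f (p + s *\<^sub>R d) - s * (df p \<bullet> d) - K / 2 * s\<^sup>2 * (norm d)\<^sup>2" for s :: real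
  have "\<phi> 1 \<le> \<phi> 0"
  proof (rule DERIV_nonpos_imp_nonincreasing, simp)
    fix s :: real assume s: "0 \<le> s" "s \<le> 1"
    have "((\<lambda>s. p + s *\<^sub>R d) has_derivative (\<lambda>s. s *\<^sub>R d)) (at s)"
      by (auto intro!: derivative_eq_intros)
    moreover have "(f has_derivative (\<lambda>e. df (p + s *\<^sub>R d) \<bullet> e)) (at (p + s *\<^sub>R d))"
      using df by (simp add: gderiv_def inner_commute)
    ultimately have "((\<lambda>s. f (p + s *\<^sub>R d)) has_derivative
        (\<lambda>r. df (p + s *\<^sub>R d) \<bullet> (r *\<^sub>R d))) (at s)"
      by (rule has_derivative_compose)
    then have "((\<lambda>s. f (p + s *\<^sub>R d)) has_real_derivative (df (p + s *\<^sub>R d) \<bullet> d)) (at s)"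
      by (simp add: has_field_derivative_def mult_commute_abs)
    then have "(\<phi> has_real_derivative
        (df (p + s *\<^sub>R d) - df p) \<bullet> d - K * s * (norm d)\<^sup>2) (at s)"
      unfolding \<phi>_def by (auto intro!: derivative_eq_intros simp: inner_diff_left)
    moreover have "(df (p + s *\<^sub>R d) - df p) \<bullet> d \<le> K * s * (norm d)\<^sup>2"
    proof -
      have "norm (df (p + s *\<^sub>R d) - df p) \<le> K * (s * norm d)"
        using lipschitz_onD[OF lip, of "p + s *\<^sub>R d" p] s by (simp add: dist_norm)
      then have "norm (df (p + s *\<^sub>R d) - df p) * norm d \<le> K * (s * norm d) * norm d"
        by (rule mult_right_mono) simp
      then show ?thesis
        using norm_cauchy_schwarz[of "df (p + s *\<^sub>R d) - df p" d]
        by (simp add: power2_eq_square mult.assoc)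
    qed
    ultimately show "\<exists>y. DERIV \<phi> s :> y \<and> y \<le> 0" by force
  qed
  then show ?thesis by (simp add: \<phi>_def d_def)
qed

lemma convex_fun_real_of_ereal:
  assumes F: "convex_fun F" "\<And>z. F z \<noteq> -\<infinity>" and "x \<in> edom F" "y \<in> edom F" "0 \<le> s" "s \<le> 1"
  shows "(1 - s) *\<^sub>R x + s *\<^sub>R y \<in> edom F"
    and "real_of_ereal (F ((1 - s) *\<^sub>R x + s *\<^sub>R y))
           \<le> (1 - s) * real_of_ereal (F x) + s * real_of_ereal (F y)"
proof -
  let ?w = "(1 - s) *\<^sub>R x + s *\<^sub>R y"
  obtain a c where ac: "F x = ereal a" "F y = ereal c"
    using assms(3,4) F(2)[of x] F(2)[of y] by (cases "F x"; cases "F y") (auto simp: edom_def)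
  have "F ?w \<le> ereal (1 - s) * F x + ereal s * F y"
    using F(1) assms(5,6) by (auto simp: convex_fun_def)
  then have le: "F ?w \<le> ereal ((1 - s) * a + s * c)" by (simp add: ac)
  then show "?w \<in> edom F" by (auto simp: edom_def)
  show "real_of_ereal (F ?w) \<le> (1 - s) * real_of_ereal (F x) + s * real_of_ereal (F y)"
    using le F(2)[of ?w] by (cases "F ?w") (auto simp: ac)
qed

lemma inner_three_point:
  fixes w w' z :: "'a::real_inner"
  shows "(w' - w) \<bullet> (z - w') = ((norm (w - z))\<^sup>2 - (norm (w' - z))\<^sup>2 - (norm (w' - w))\<^sup>2) / 2"
  by (simp add: power2_norm_eq_inner inner_diff inner_commute field_simps)

lemma averaging_step_scaled:
  fixes x :: "'a::real_vector" and \<tau> :: real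
  assumes "\<tau> \<noteq> 0" and x': "x' = (1 / \<tau>) *\<^sub>R w + ((\<tau> - 1) / \<tau>) *\<^sub>R x"
  shows "\<tau>\<^sup>2 *\<^sub>R x' = \<tau> *\<^sub>R w + (\<tau>\<^sup>2 - \<tau>) *\<^sub>R x"
proof -
  have "\<tau>\<^sup>2 * (1 / \<tau>) = \<tau>" "\<tau>\<^sup>2 * ((\<tau> - 1) / \<tau>) = \<tau>\<^sup>2 - \<tau>"
    using assms(1) by (simp_all add: field_simps power2_eq_square)
  then show ?thesis
    unfolding x' scaleR_add_right scaleR_scaleR by simp
qed

text \<open>Serves both primal blocks: \<open>c\<close> is the multiplier term,
  \<open>\<sigma>\<close> the weight of the proximal term, and \<open>\<mu> = 0\<close> the merely
  convex case. The averages \<open>x'\<close> and \<open>xbar\<close> share \<open>x\<close>, so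
  they differ by \<open>(w' - w) / \<tau>\<close>, and scaling by \<open>\<tau>\<^sup>2\<close>
  leaves a smoothness error free of \<open>\<tau>\<close>.\<close>

lemma accelerated_composite_step:
  fixes h1 :: "'a::real_inner \<Rightarrow> ereal" and h2 :: "'a \<Rightarrow> real"
  defines "h \<equiv> \<lambda>z. real_of_ereal (h1 z) + h2 z"
  assumes h1: "convex_fun h1" "\<And>z. h1 z \<noteq> -\<infinity>"
    and h2: "convex_on UNIV h2" "\<And>z. GDERIV h2 z :> dh2 z" "K-lipschitz_on UNIV dh2"
    and dom: "x \<in> edom h1" "w' \<in> edom h1"
    and \<tau>: "\<tau> \<ge> 1"
    and xbar: "xbar = (1 / \<tau>) *\<^sub>R w + ((\<tau> - 1) / \<tau>) *\<^sub>R x"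
    and x': "x' = (1 / \<tau>) *\<^sub>R w' + ((\<tau> - 1) / \<tau>) *\<^sub>R x"
    and sub: "real_of_ereal (h1 w') + (- (c + dh2 xbar + \<sigma> *\<^sub>R (w' - w))) \<bullet> (z - w')
                + \<mu> / 2 * (norm (z - w'))\<^sup>2 \<le> real_of_ereal (h1 z)"
  shows "x' \<in> edom h1"
    and "\<tau>\<^sup>2 * (h x' - h z) \<le> (\<tau>\<^sup>2 - \<tau>) * (h x - h z) + \<tau> * (c \<bullet> (z - w'))
           + \<tau> * \<sigma> / 2 * ((norm (w - z))\<^sup>2 - (norm (w' - z))\<^sup>2 - (norm (w' - w))\<^sup>2)
           - \<tau> * \<mu> / 2 * (norm (w' - z))\<^sup>2 + K / 2 * (norm (w' - w))\<^sup>2"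
proof -
  have \<tau>0: "\<tau> > 0" using \<tau> by simp
  have x'': "x' = (1 - 1 / \<tau>) *\<^sub>R x + (1 / \<tau>) *\<^sub>R w'"
    using \<tau>0 by (simp add: x' field_simps)
  show "x' \<in> edom h1"
    unfolding x'' using \<tau> by (intro convex_fun_real_of_ereal[OF h1 dom]) auto
  have "real_of_ereal (h1 x') \<le> (1 - 1 / \<tau>) * real_of_ereal (h1 x) + 1 / \<tau> * real_of_ereal (h1 w')"
    unfolding x'' using \<tau> by (intro convex_fun_real_of_ereal[OF h1 dom]) auto
  then have "\<tau>\<^sup>2 * real_of_ereal (h1 x')
      \<le> \<tau>\<^sup>2 * ((1 - 1 / \<tau>) * real_of_ereal (h1 x) + 1 / \<tau> * real_of_ereal (h1 w'))"
    by (rule mult_left_mono) simp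
  also have "\<dots> = (\<tau>\<^sup>2 - \<tau>) * real_of_ereal (h1 x) + \<tau> * real_of_ereal (h1 w')"
    using \<tau>0 by (simp add: field_simps power2_eq_square)
  finally have 1: "\<tau>\<^sup>2 * real_of_ereal (h1 x')
      \<le> (\<tau>\<^sup>2 - \<tau>) * real_of_ereal (h1 x) + \<tau> * real_of_ereal (h1 w')" .
  have "x' - xbar = (1 / \<tau>) *\<^sub>R (w' - w)"
    by (simp add: x' xbar algebra_simps)
  then have nrm: "\<tau>\<^sup>2 * (norm (x' - xbar))\<^sup>2 = (norm (w' - w))\<^sup>2"
    using \<tau>0 by (simp add: power_divide)
  \<comment> \<open>The weights \<open>\<tau>\<^sup>2 - \<tau>\<close> and \<open>\<tau>\<close> add
    up to \<open>\<tau>\<^sup>2\<close>, so the linear model of \<open>h2\<close> at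
    \<open>xbar\<close> splits into a part compared with \<open>x\<close> and a part compared with
    \<open>z\<close>.\<close>
  have split: "\<tau>\<^sup>2 * (dh2 xbar \<bullet> (x' - xbar))
      = (\<tau>\<^sup>2 - \<tau>) * (dh2 xbar \<bullet> (x - xbar)) + \<tau> * (dh2 xbar \<bullet> (w' - xbar))"
  proof -
    have "\<tau>\<^sup>2 *\<^sub>R (x' - xbar) = (\<tau>\<^sup>2 - \<tau>) *\<^sub>R (x - xbar) + \<tau> *\<^sub>R (w' - xbar)"
      using averaging_step_scaled[OF _ x'] \<tau>0 by (simp add: algebra_simps)
    then show ?thesis by (metis inner_add_right inner_scaleR_right)
  qed
  have "\<tau>\<^sup>2 * h2 x' \<le> \<tau>\<^sup>2 * (h2 xbar + dh2 xbar \<bullet> (x' - xbar) + K / 2 * (norm (x' - xbar))\<^sup>2)"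
    by (intro mult_left_mono lipschitz_gradient_upper_bound h2) simp
  also have "\<dots> = (\<tau>\<^sup>2 - \<tau>) * (h2 xbar + dh2 xbar \<bullet> (x - xbar))
      + \<tau> * (h2 xbar + dh2 xbar \<bullet> (w' - xbar)) + K / 2 * (norm (w' - w))\<^sup>2"
    using split nrm by (simp add: algebra_simps)
  also have "\<dots> \<le> (\<tau>\<^sup>2 - \<tau>) * h2 x + \<tau> * (h2 z + dh2 xbar \<bullet> (w' - z)) + K / 2 * (norm (w' - w))\<^sup>2"
  proof -
    have "(\<tau>\<^sup>2 - \<tau>) * (h2 xbar + dh2 xbar \<bullet> (x - xbar)) \<le> (\<tau>\<^sup>2 - \<tau>) * h2 x"
      using \<tau> by (intro mult_left_mono convex_gradient_inequality h2) (simp add: power2_eq_square)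
    moreover have "h2 xbar + dh2 xbar \<bullet> (w' - xbar) \<le> h2 z + dh2 xbar \<bullet> (w' - z)"
      using convex_gradient_inequality[OF h2(1,2), of xbar z] by (simp add: inner_diff_right)
    then have "\<tau> * (h2 xbar + dh2 xbar \<bullet> (w' - xbar)) \<le> \<tau> * (h2 z + dh2 xbar \<bullet> (w' - z))"
      using \<tau>0 by (intro mult_left_mono) auto
    ultimately show ?thesis by simp
  qed
  finally have 2: "\<tau>\<^sup>2 * h2 x' \<le> (\<tau>\<^sup>2 - \<tau>) * h2 x + \<tau> * (h2 z + dh2 xbar \<bullet> (w' - z))
      + K / 2 * (norm (w' - w))\<^sup>2" .
  have "real_of_ereal (h1 w') \<le> real_of_ereal (h1 z) + c \<bullet> (z - w') - dh2 xbar \<bullet> (w' - z)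
      + \<sigma> / 2 * ((norm (w - z))\<^sup>2 - (norm (w' - z))\<^sup>2 - (norm (w' - w))\<^sup>2)
      - \<mu> / 2 * (norm (w' - z))\<^sup>2"
  proof -
    have "(- (c + dh2 xbar + \<sigma> *\<^sub>R (w' - w))) \<bullet> (z - w')
        = - (c \<bullet> (z - w')) + dh2 xbar \<bullet> (w' - z) - \<sigma> * ((w' - w) \<bullet> (z - w'))"
      by (simp add: inner_add_left inner_diff_left inner_diff_right algebra_simps)
    then show ?thesis
      using sub by (simp add: inner_three_point[of w' w z] norm_minus_commute[of z w'])
  qed
  from mult_left_mono[OF this, of \<tau>] 1 2 \<tau>0
  show "\<tau>\<^sup>2 * (h x' - h z) \<le> (\<tau>\<^sup>2 - \<tau>) * (h x - h z) + \<tau> * (c \<bullet> (z - w'))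
           + \<tau> * \<sigma> / 2 * ((norm (w - z))\<^sup>2 - (norm (w' - z))\<^sup>2 - (norm (w' - w))\<^sup>2)
           - \<tau> * \<mu> / 2 * (norm (w' - z))\<^sup>2 + K / 2 * (norm (w' - w))\<^sup>2"
    unfolding h_def by (simp add: algebra_simps)
qed

text \<open>\<open>s k\<close> is the difference of \<open>s k + S k\<close> and the partial sum
  \<open>S k\<close>. Weights in [0, 1] keep the partial sums under the same bound \<open>M\<close>;
  the subtraction costs the factor 2.\<close>

lemma norm_le_of_weighted_partial_sums:
  fixes s :: "nat \<Rightarrow> 'a::real_normed_vector"
  assumes c: "\<And>j. j \<ge> 1 \<Longrightarrow> 0 \<le> c j" "\<And>j. j \<ge> 1 \<Longrightarrow> c j \<le> 1"
    and M: "\<And>k. k \<ge> 1 \<Longrightarrow> norm (s k + (\<Sum>j=1..<k. c j *\<^sub>R s j)) \<le> M"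
    and "k \<ge> 1"
  shows "norm (s k) \<le> 2 * M"
proof -
  define S where "S k = (\<Sum>j=1..<k. c j *\<^sub>R s j)" for k
  have S: "norm (S k) \<le> M" if "k \<ge> 1" for k
    using that
  proof (induction k rule: dec_induct)
    case base
    \<comment> \<open>The first partial sum is empty, so only \<open>M \<ge> 0\<close> is at stake,
      and \<open>M\<close> bounds a norm.\<close>
    show ?case using order_trans[OF norm_ge_zero M[of 1]] by (simp add: S_def)
  next
    case (step k)
    \<comment> \<open>The next partial sum is a convex combination of two vectors of norm at most \<open>M\<close>.\<close>
    have "S (Suc k) = (1 - c k) *\<^sub>R S k + c k *\<^sub>R (s k + S k)"
      using step.hyps by (simp add: S_def algebra_simps)
    then have "norm (S (Suc k)) \<le> (1 - c k) * norm (S k) + c k * norm (s k + S k)"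
      using c[of k] step.hyps norm_triangle_ineq[of "(1 - c k) *\<^sub>R S k" "c k *\<^sub>R (s k + S k)"] by simp
    also have "\<dots> \<le> (1 - c k) * M + c k * M"
      using c[of k] step M[of k] by (intro add_mono mult_left_mono) (auto simp: S_def)
    finally show ?case by (simp add: algebra_simps)
  qed
  have "norm (s k) \<le> norm (s k + S k) + norm (S k)"
    using norm_triangle_ineq4[of "s k + S k" "S k"] by simp
  then show ?thesis using S[OF \<open>k \<ge> 1\<close>] M[OF \<open>k \<ge> 1\<close>] by (simp add: S_def)
qed

text \<open>The three-point identity for \<open>l\<close>, \<open>l'\<close>, \<open>ls\<close>
  supplies the square of \<open>r\<close>, and the correction in \<open>lbar\<close> the mixed term;
  the added square of \<open>e\<close> completes the square of \<open>r - e\<close>, which is the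
  exact slack up to a factor.\<close>

lemma multiplier_step:
  fixes r :: "'a::real_inner"
  assumes "\<gamma> > 0" and l': "l' = l + (\<gamma> * \<tau>) *\<^sub>R r" and lbar: "lbar = l' - (\<gamma> * \<tau>) *\<^sub>R e"
  shows "\<tau> * ((ls - lbar) \<bullet> r)
           \<le> ((norm (l - ls))\<^sup>2 - (norm (l' - ls))\<^sup>2) / (2 * \<gamma>) + \<gamma> * \<tau>\<^sup>2 / 2 * (norm e)\<^sup>2"
proof -
  have "((norm (l - ls))\<^sup>2 - (norm (l' - ls))\<^sup>2) / (2 * \<gamma>) + \<gamma> * \<tau>\<^sup>2 / 2 * (norm e)\<^sup>2
      - \<tau> * ((ls - lbar) \<bullet> r) = \<gamma> * \<tau>\<^sup>2 / 2 * (norm (r - e))\<^sup>2"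
    using \<open>\<gamma> > 0\<close> unfolding l' lbar power2_norm_eq_inner
    by (simp add: inner_diff inner_add inner_commute field_simps power2_eq_square)
  then show ?thesis using \<open>\<gamma> > 0\<close> by (smt (verit) mult_nonneg_nonneg divide_nonneg_pos zero_le_power2)
qed

text \<open>One gradient formula for both subproblems: the penalised step takes
  \<open>\<theta> = \<gamma> * \<tau>\<close>, the proximal step takes \<open>c = 0\<close> and
  \<open>\<theta> = 0\<close>.\<close>

lemma GDERIV_linear_plus_quadratics:
  fixes A :: "real^'m^'p"
  shows "GDERIV (\<lambda>w. c \<bullet> w + \<theta> / 2 * (norm (A *v w + d))\<^sup>2 + \<rho> / 2 * (norm (w - u))\<^sup>2) p
           :> c + transpose A *v (\<theta> *\<^sub>R (A *v p + d)) + \<rho> *\<^sub>R (p - u)"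
proof -
  have A: "((\<lambda>w. A *v w) has_derivative (\<lambda>h. A *v h)) (at p)"
    by (rule bounded_linear_imp_has_derivative) simp
  have tr: "h \<bullet> (e v* A) = (A *v h) \<bullet> e" for h e
    by (metis dot_lmul_matrix inner_commute)
  show ?thesis
    unfolding gderiv_def power2_norm_eq_inner
    by (rule derivative_eq_intros A refl | simp)+
      (auto simp: fun_eq_iff tr inner_add inner_diff inner_commute field_simps)
qed

theorem theorem6:
  fixes f f1 :: "real^'m \<Rightarrow> ereal" and f2 :: "real^'m \<Rightarrow> real" and df2 :: "real^'m \<Rightarrow> real^'m"
    and g g1 :: "real^'n \<Rightarrow> ereal" and g2 :: "real^'n \<Rightarrow> real" and dg2 :: "real^'n \<Rightarrow> real^'n"
    and A :: "real^'m^'p" and B :: "real^'n^'p" and b :: "real^'p"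
    and L :: "real^'m \<Rightarrow> real^'n \<Rightarrow> real^'p \<Rightarrow> ereal"
    and Lf2 Lg2 \<mu>g \<alpha> \<beta> \<gamma> E1 C2 :: real
    and t :: "nat \<Rightarrow> real"
    and x u :: "nat \<Rightarrow> real^'m" and y v :: "nat \<Rightarrow> real^'n" and \<Lambda> :: "nat \<Rightarrow> real^'p"
    and xs :: "real^'m" and ys :: "real^'n" and ls :: "real^'p"
  assumes f_def: "f = (\<lambda>z. f1 z + ereal (f2 z))"
    and g_def: "g = (\<lambda>z. g1 z + ereal (g2 z))"
    and f1_values: "\<And>z. f1 z \<noteq> - \<infinity>"
    and f1: "proper_fun f1" "closed_fun f1" "convex_fun f1"
    and f2: "convex_on UNIV f2"
    and df2: "\<And>z. GDERIV f2 z :> df2 z" "Lf2-lipschitz_on UNIV df2"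
    and g1_values: "\<And>z. g1 z \<noteq> - \<infinity>"
    and \<mu>g: "\<mu>g > 0"
    and g1: "proper_fun g1" "closed_fun g1" "strongly_convex_fun \<mu>g g1"
    and g2: "convex_on UNIV g2"
    and dg2: "\<And>z. GDERIV g2 z :> dg2 z" "Lg2-lipschitz_on UNIV dg2"
    and L_def: "L = lagrangian f g A B b"
    and saddle: "(xs, ys, ls) \<in> saddle_points L"
    and params: "\<alpha> > 0" "\<beta> > 0" "\<gamma> > 0"
    and iterates: "accelerated_iterates f f1 df2 g g1 dg2 A B b \<alpha> \<beta> \<gamma> t x y u v \<Lambda>"
    and \<alpha>_le: "ereal \<alpha> \<le> 1 / ereal Lf2"
    and \<beta>_le: "ereal \<beta> \<le> ereal ((t 1)\<^sup>2) / ereal (Lg2 + (t 1)\<^sup>2 * \<gamma> * (matrix_opnorm B)\<^sup>2)"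
    and t_ge: "\<And>k. k \<ge> 1 \<Longrightarrow> t k \<ge> 1"
    and t_mono: "mono_on {1..} t"
    and t_step1: "\<And>k. k \<ge> 1 \<Longrightarrow> (t (k + 1))\<^sup>2 \<le> (t k)\<^sup>2 + t (k + 1)"
    and t_step2: "\<And>k. k \<ge> 1 \<Longrightarrow> (t (k + 1))\<^sup>2 \<le> (t k)\<^sup>2 + \<beta> * \<mu>g * t k"
    and E1_def: "E1 = (t 1)\<^sup>2 * real_of_ereal (L (x 1) (y 1) ls - L xs ys ls)
                  + 1 / (2 * \<alpha>) * (norm (x 1 - xs))\<^sup>2
                  + (t 2)\<^sup>2 / (2 * \<beta>) * (norm (y 1 - ys))\<^sup>2
                  + 1 / (2 * \<gamma>) * (norm (\<Lambda> 1 - ls))\<^sup>2"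
    and C2_def: "C2 = 3 * (t 1)\<^sup>2 * norm (A *v x 1 + B *v y 1 - b)
                  + (2 * norm (\<Lambda> 1 - ls) + 2 * sqrt (2 * \<gamma> * E1)) / \<gamma>"
  shows "\<forall>k\<ge>1.
           L (x k) (y k) ls - L xs ys ls \<le> ereal (E1 / (t k)\<^sup>2) \<and>
           norm (A *v x k + B *v y k - b) \<le> C2 / (t k)\<^sup>2 \<and>
           \<bar>f (x k) + g (y k) - f xs - g ys\<bar> \<le> ereal ((E1 + C2 * norm ls) / (t k)\<^sup>2)"
proof -

  \<comment> \<open>Passage from extended-real to real values\<close>
  have \<tau>pos: "t k > 0" if "k \<ge> 1" for k using t_ge[OF that] by simp
  define F where "F z = real_of_ereal (f1 z) + f2 z" for z
  define G where "G z = real_of_ereal (g1 z) + g2 z" for z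
  define r where "r p q = A *v p + B *v q - b" for p q
  have edom_f: "edom f = edom f1" and edom_g: "edom g = edom g1"
    using f1_values g1_values by (auto simp: f_def g_def edom_def plus_ereal.simps less_ereal.simps)
  have f_real: "f z = ereal (F z)" if "z \<in> edom f1" for z
    using that f1_values[of z] by (cases "f1 z") (auto simp: f_def F_def edom_def)
  have g_real: "g z = ereal (G z)" if "z \<in> edom g1" for z
    using that g1_values[of z] by (cases "g1 z") (auto simp: g_def G_def edom_def)
  have L_real: "L p q l = ereal (F p + G q + l \<bullet> r p q)" if "p \<in> edom f1" "q \<in> edom g1" for p q l
    using that by (simp add: L_def lagrangian_def f_real g_real r_def)
  note it = iterates[unfolded accelerated_iterates_def Let_def edom_f edom_g]
  have init: "x 1 = x 0" "u 1 = x 1" "x 1 \<in> edom f1" "y 1 = y 0" "v 1 = y 1" "y 1 \<in> edom g1"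
    using it by blast+

  \<comment> \<open>Finiteness and feasibility of the saddle point\<close>
  have sad1: "L xs ys l \<le> L xs ys ls" and sad2: "L xs ys ls \<le> L p q ls" for p q l
    using saddle by (auto simp: saddle_points_def)
  have "L xs ys ls < \<infinity>"
    using sad2[of "x 1" "y 1"] init by (auto simp: L_real)
  then have dom_s: "xs \<in> edom f1" "ys \<in> edom g1"
    using f1_values[of xs] g1_values[of ys]
    by (auto simp: L_def lagrangian_def f_def g_def edom_def)
  have feas: "r xs ys = 0"
  proof -
    \<comment> \<open>Moving the multiplier from \<open>ls\<close> to \<open>ls + r xs ys\<close>
      raises the Lagrangian by the squared norm of the residual.\<close>
    have "(r xs ys) \<bullet> (r xs ys) \<le> 0"
      using sad1[of "ls + r xs ys"] dom_s by (simp add: L_real inner_add_left)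
    then show ?thesis by (metis antisym inner_eq_zero_iff inner_ge_zero)
  qed
  \<comment> \<open>By \<open>feas\<close> the saddle value is \<open>F xs + G ys\<close>, so
    \<open>D\<close> is the Lagrangian gap. The \<open>v\<close> term of \<open>E\<close> carries
    the index \<open>k + 1\<close> because that is the proximal weight of the next
    iteration.\<close>
  define D where "D k = F (x k) + G (y k) + ls \<bullet> r (x k) (y k) - (F xs + G ys)" for k
  define E where "E k = (t k)\<^sup>2 * D k + 1 / (2 * \<alpha>) * (norm (u k - xs))\<^sup>2
      + (t (k + 1))\<^sup>2 / (2 * \<beta>) * (norm (v k - ys))\<^sup>2
      + 1 / (2 * \<gamma>) * (norm (\<Lambda> k - ls))\<^sup>2" for k

  \<comment> \<open>A zero denominator makes the quotient infinite; the product form covers that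
    case too, its left side being zero. The same holds for \<open>Lg_bound\<close>.\<close>
  have Lf_bound: "Lf2 * \<alpha> \<le> 1"
    using \<alpha>_le lipschitz_on_nonneg[OF df2(2)] by (cases "Lf2 = 0") (auto simp: field_simps one_ereal_def)
  have Lg0: "Lg2 \<ge> 0" using lipschitz_on_nonneg[OF dg2(2)] .
  have Lg_bound: "\<beta> * (Lg2 + (t 1)\<^sup>2 * \<gamma> * (matrix_opnorm B)\<^sup>2) \<le> (t 1)\<^sup>2"
  proof -
    let ?N = "Lg2 + (t 1)\<^sup>2 * \<gamma> * (matrix_opnorm B)\<^sup>2"
    have "?N \<ge> 0" using Lg0 params by simp
    then show ?thesis using \<beta>_le by (cases "?N = 0") (auto simp: field_simps)
  qed
  have g1_convex: "convex_fun g1"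
    using g1(3) by (simp add: strongly_convex_fun_def)

  \<comment> \<open>Energy decrease in one iteration\<close>
  have energy_step: "x (k + 1) \<in> edom f1 \<and> y (k + 1) \<in> edom g1 \<and> E (k + 1) \<le> E k
      \<and> \<Lambda> (k + 1) = \<Lambda> k + \<gamma> *\<^sub>R ((t (k + 1))\<^sup>2 *\<^sub>R r (x (k + 1)) (y (k + 1))
            - ((t (k + 1))\<^sup>2 - t (k + 1)) *\<^sub>R r (x k) (y k))"
    if k: "k \<ge> 1" and xk: "x k \<in> edom f1" and yk: "y k \<in> edom g1"
      and uk: "u k = t k *\<^sub>R x k - (t k - 1) *\<^sub>R x (k - 1)"
      and vk: "v k = t k *\<^sub>R y k - (t k - 1) *\<^sub>R y (k - 1)" for k
  proof -
    define \<tau> where "\<tau> = t (k + 1)"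
    have \<tau>1: "\<tau> \<ge> 1" and \<tau>0: "\<tau> > 0" using t_ge[of "k + 1"] by (auto simp: \<tau>_def)
    define xbar where "xbar = x k + ((t k - 1) / \<tau>) *\<^sub>R (x k - x (k - 1))"
    define ybar where "ybar = y k + ((t k - 1) / \<tau>) *\<^sub>R (y k - y (k - 1))"
    define lbar where "lbar = \<Lambda> k + (\<gamma> * \<tau>) *\<^sub>R (A *v u (k + 1) + B *v v k - b)"
    have itk:
      "is_argmin (\<lambda>w. f1 w + ereal ((transpose A *v \<Lambda> k + df2 xbar) \<bullet> w
                  + \<gamma> * \<tau> / 2 * (norm (A *v w + B *v v k - b))\<^sup>2
                  + 1 / (2 * \<alpha> * \<tau>) * (norm (w - u k))\<^sup>2)) (u (k + 1))"
      "is_prox (\<beta> / \<tau>) g1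
            (v k - (\<beta> / \<tau>) *\<^sub>R (transpose B *v lbar + dg2 ybar)) (v (k + 1))"
      and x': "x (k + 1) = (1 / \<tau>) *\<^sub>R u (k + 1) + ((\<tau> - 1) / \<tau>) *\<^sub>R x k"
      and y': "y (k + 1) = (1 / \<tau>) *\<^sub>R v (k + 1) + ((\<tau> - 1) / \<tau>) *\<^sub>R y k"
      and \<Lambda>': "\<Lambda> (k + 1) = \<Lambda> k + (\<gamma> * \<tau>) *\<^sub>R r (u (k + 1)) (v (k + 1))"
      using it k unfolding \<tau>_def xbar_def ybar_def lbar_def r_def by blast+
    \<comment> \<open>The representation \<open>uk\<close> turns the extrapolated point into an
      average of \<open>u k\<close> and \<open>x k\<close> with the weights that form
      \<open>x (k + 1)\<close>, as the composite step requires.\<close>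
    have xbar: "xbar = (1 / \<tau>) *\<^sub>R u k + ((\<tau> - 1) / \<tau>) *\<^sub>R x k"
      using \<tau>0 by (simp add: xbar_def uk algebra_simps add_divide_distrib diff_divide_distrib)
    have ybar: "ybar = (1 / \<tau>) *\<^sub>R v k + ((\<tau> - 1) / \<tau>) *\<^sub>R y k"
      using \<tau>0 by (simp add: ybar_def vk algebra_simps add_divide_distrib diff_divide_distrib)

    \<comment> \<open>Proximal estimate for the first block\<close>
    have "- (transpose A *v lbar + df2 xbar + (1 / (\<alpha> * \<tau>)) *\<^sub>R (u (k + 1) - u k))
        \<in> subdifferential f1 (u (k + 1))"
    proof (rule argmin_gradient_in_subdifferential[OF f1(3) f1_values f1(1) _ itk(1)])
      \<comment> \<open>The gradient of the penalty merges with
        \<open>transpose A *v \<Lambda> k\<close> into \<open>transpose A *v lbar\<close>, as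
        \<open>lbar\<close> is the multiplier updated with \<open>u (k + 1)\<close> and
        \<open>v k\<close>.\<close>
      show "GDERIV (\<lambda>w. (transpose A *v \<Lambda> k + df2 xbar) \<bullet> w
              + \<gamma> * \<tau> / 2 * (norm (A *v w + B *v v k - b))\<^sup>2
              + 1 / (2 * \<alpha> * \<tau>) * (norm (w - u k))\<^sup>2) (u (k + 1))
            :> transpose A *v lbar + df2 xbar + (1 / (\<alpha> * \<tau>)) *\<^sub>R (u (k + 1) - u k)"
        using GDERIV_linear_plus_quadratics[of "transpose A *v \<Lambda> k + df2 xbar" "\<gamma> * \<tau>" A
            "B *v v k - b" "1 / (\<alpha> * \<tau>)" "u k" "u (k + 1)"]
        by (simp add: lbar_def matrix_vector_right_distrib add_ac add_diff_eq mult_ac)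
    qed
    then have u_dom: "u (k + 1) \<in> edom f1"
      and u_sub: "f1 (u (k + 1)) + ereal ((- (transpose A *v lbar + df2 xbar
          + (1 / (\<alpha> * \<tau>)) *\<^sub>R (u (k + 1) - u k))) \<bullet> (xs - u (k + 1))) \<le> f1 xs"
      by (auto simp: subdifferential_def edom_def)
    have f_step: "x (k + 1) \<in> edom f1"
      "\<tau>\<^sup>2 * (F (x (k + 1)) - F xs) \<le> (\<tau>\<^sup>2 - \<tau>) * (F (x k) - F xs)
          + \<tau> * ((transpose A *v lbar) \<bullet> (xs - u (k + 1)))
          + \<tau> * (1 / (\<alpha> * \<tau>)) / 2 * ((norm (u k - xs))\<^sup>2 - (norm (u (k + 1) - xs))\<^sup>2
              - (norm (u (k + 1) - u k))\<^sup>2)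
          - \<tau> * 0 / 2 * (norm (u (k + 1) - xs))\<^sup>2 + Lf2 / 2 * (norm (u (k + 1) - u k))\<^sup>2"
    proof -
      \<comment> \<open>\<open>f1\<close> is only assumed convex, hence the modulus 0.\<close>
      have sub: "real_of_ereal (f1 (u (k + 1)))
          + (- (transpose A *v lbar + df2 xbar + (1 / (\<alpha> * \<tau>)) *\<^sub>R (u (k + 1) - u k))) \<bullet> (xs - u (k + 1))
          + 0 / 2 * (norm (xs - u (k + 1)))\<^sup>2 \<le> real_of_ereal (f1 xs)"
        using u_sub u_dom dom_s f1_values[of xs] f1_values[of "u (k + 1)"]
        by (cases "f1 xs"; cases "f1 (u (k + 1))") (auto simp: edom_def)
      note step = accelerated_composite_step[OF f1(3) f1_values f2 df2 xk u_dom \<tau>1 xbar x' sub]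
      show "x (k + 1) \<in> edom f1" by (rule step(1))
      show "\<tau>\<^sup>2 * (F (x (k + 1)) - F xs) \<le> (\<tau>\<^sup>2 - \<tau>) * (F (x k) - F xs)
          + \<tau> * ((transpose A *v lbar) \<bullet> (xs - u (k + 1)))
          + \<tau> * (1 / (\<alpha> * \<tau>)) / 2 * ((norm (u k - xs))\<^sup>2 - (norm (u (k + 1) - xs))\<^sup>2
              - (norm (u (k + 1) - u k))\<^sup>2)
          - \<tau> * 0 / 2 * (norm (u (k + 1) - xs))\<^sup>2 + Lf2 / 2 * (norm (u (k + 1) - u k))\<^sup>2"
        unfolding F_def by (rule step(2))
    qed

    \<comment> \<open>Proximal estimate for the second block\<close>
    have "- (transpose B *v lbar + dg2 ybar + (\<tau> / \<beta>) *\<^sub>R (v (k + 1) - v k))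
        \<in> subdifferential g1 (v (k + 1))"
    proof (rule argmin_gradient_in_subdifferential[OF g1_convex g1_values g1(1) _
          itk(2)[unfolded is_prox_def]])
      \<comment> \<open>The shift of the prox centre, multiplied by the weight
        \<open>\<tau> / \<beta>\<close>, gives back the linear term.\<close>
      show "GDERIV (\<lambda>w. 1 / (2 * (\<beta> / \<tau>)) * (norm (w - (v k
              - (\<beta> / \<tau>) *\<^sub>R (transpose B *v lbar + dg2 ybar))))\<^sup>2) (v (k + 1))
            :> transpose B *v lbar + dg2 ybar + (\<tau> / \<beta>) *\<^sub>R (v (k + 1) - v k)"
        using GDERIV_linear_plus_quadratics[of 0 0 B 0 "\<tau> / \<beta>"
            "v k - (\<beta> / \<tau>) *\<^sub>R (transpose B *v lbar + dg2 ybar)" "v (k + 1)"] \<tau>0 params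
        by (simp add: algebra_simps)
    qed
    then have v_dom: "v (k + 1) \<in> edom g1"
      and v_sub: "ereal (\<mu>g / 2 * (norm (ys - v (k + 1)))\<^sup>2) \<le> g1 ys - g1 (v (k + 1))
          - ereal ((- (transpose B *v lbar + dg2 ybar
            + (\<tau> / \<beta>) *\<^sub>R (v (k + 1) - v k))) \<bullet> (ys - v (k + 1)))"
      using g1(3) by (auto simp: subdifferential_def edom_def strongly_convex_fun_def)
    have g_step: "y (k + 1) \<in> edom g1"
      "\<tau>\<^sup>2 * (G (y (k + 1)) - G ys) \<le> (\<tau>\<^sup>2 - \<tau>) * (G (y k) - G ys)
          + \<tau> * ((transpose B *v lbar) \<bullet> (ys - v (k + 1)))
          + \<tau> * (\<tau> / \<beta>) / 2 * ((norm (v k - ys))\<^sup>2 - (norm (v (k + 1) - ys))\<^sup>2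
              - (norm (v (k + 1) - v k))\<^sup>2)
          - \<tau> * \<mu>g / 2 * (norm (v (k + 1) - ys))\<^sup>2 + Lg2 / 2 * (norm (v (k + 1) - v k))\<^sup>2"
    proof -
      have sub: "real_of_ereal (g1 (v (k + 1)))
          + (- (transpose B *v lbar + dg2 ybar + (\<tau> / \<beta>) *\<^sub>R (v (k + 1) - v k))) \<bullet> (ys - v (k + 1))
          + \<mu>g / 2 * (norm (ys - v (k + 1)))\<^sup>2 \<le> real_of_ereal (g1 ys)"
        using v_sub v_dom dom_s g1_values[of ys] g1_values[of "v (k + 1)"]
        by (cases "g1 ys"; cases "g1 (v (k + 1))") (auto simp: edom_def)
      note step = accelerated_composite_step[OF g1_convex g1_values g2 dg2 yk v_dom \<tau>1 ybar y' sub]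
      show "y (k + 1) \<in> edom g1" by (rule step(1))
      show "\<tau>\<^sup>2 * (G (y (k + 1)) - G ys) \<le> (\<tau>\<^sup>2 - \<tau>) * (G (y k) - G ys)
          + \<tau> * ((transpose B *v lbar) \<bullet> (ys - v (k + 1)))
          + \<tau> * (\<tau> / \<beta>) / 2 * ((norm (v k - ys))\<^sup>2 - (norm (v (k + 1) - ys))\<^sup>2
              - (norm (v (k + 1) - v k))\<^sup>2)
          - \<tau> * \<mu>g / 2 * (norm (v (k + 1) - ys))\<^sup>2 + Lg2 / 2 * (norm (v (k + 1) - v k))\<^sup>2"
        unfolding G_def by (rule step(2))
    qed

    \<comment> \<open>Coupling through the constraint and the multipliers\<close>
    define w where "w = r (u (k + 1)) (v (k + 1))"
    define e where "e = B *v (v (k + 1) - v k)"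
    \<comment> \<open>Feasibility replaces \<open>A *v xs + B *v ys\<close> by \<open>b\<close>,
      which merges the two products into one with the residual \<open>w\<close>.\<close>
    have coupling: "(transpose A *v lbar) \<bullet> (xs - u (k + 1)) + (transpose B *v lbar) \<bullet> (ys - v (k + 1))
        = - (lbar \<bullet> w)"
      using arg_cong[OF feas, of "\<lambda>z. lbar \<bullet> z"]
      by (simp add: dot_lmul_matrix w_def r_def matrix_vector_mult_diff_distrib inner_add_right inner_diff_right)
    \<comment> \<open>The residual is affine and the averaging weights add up to 1, so it is
      averaged like the iterates.\<close>
    have res: "\<tau>\<^sup>2 *\<^sub>R r (x (k + 1)) (y (k + 1)) = \<tau> *\<^sub>R w + (\<tau>\<^sup>2 - \<tau>) *\<^sub>R r (x k) (y k)"
    proof -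
      have "r (x (k + 1)) (y (k + 1)) = (1 / \<tau>) *\<^sub>R w + ((\<tau> - 1) / \<tau>) *\<^sub>R r (x k) (y k)"
        using \<tau>0 unfolding x' y' w_def r_def
        by (simp add: matrix_vector_right_distrib matrix_vector_mult_scaleR algebra_simps
            diff_divide_distrib)
      then show ?thesis
        using \<tau>0 by (intro averaging_step_scaled) simp
    qed
    have lbar_eq: "lbar = \<Lambda> (k + 1) - (\<gamma> * \<tau>) *\<^sub>R e"
      unfolding \<Lambda>' lbar_def e_def r_def
      by (simp add: matrix_vector_mult_diff_distrib algebra_simps)
    have dual: "\<tau> * ((ls - lbar) \<bullet> w) \<le> ((norm (\<Lambda> k - ls))\<^sup>2 - (norm (\<Lambda> (k + 1) - ls))\<^sup>2) / (2 * \<gamma>)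
        + \<gamma> * \<tau>\<^sup>2 / 2 * (norm e)\<^sup>2"
      by (rule multiplier_step[OF params(3) \<Lambda>'[folded w_def] lbar_eq])
    have "norm e \<le> matrix_opnorm B * norm (v (k + 1) - v k)"
      unfolding e_def matrix_opnorm_def by (rule onorm) simp
    then have "(norm e)\<^sup>2 \<le> (matrix_opnorm B)\<^sup>2 * (norm (v (k + 1) - v k))\<^sup>2"
      by (metis norm_ge_zero power_mono power_mult_distrib)
    then have e_bound: "\<gamma> * \<tau>\<^sup>2 / 2 * (norm e)\<^sup>2
        \<le> \<gamma> * \<tau>\<^sup>2 / 2 * ((matrix_opnorm B)\<^sup>2 * (norm (v (k + 1) - v k))\<^sup>2)"
      using params by (intro mult_left_mono) auto

    \<comment> \<open>Comparison of the coefficients\<close>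
    have v_coeff: "Lg2 / 2 + \<gamma> * \<tau>\<^sup>2 / 2 * (matrix_opnorm B)\<^sup>2 \<le> \<tau>\<^sup>2 / (2 * \<beta>)"
    proof -
      \<comment> \<open>The bound on \<open>\<beta>\<close> is stated at \<open>t 1\<close>. It
        carries over to \<open>\<tau>\<close>: after division by the squared weight only the
        \<open>Lg2\<close> term depends on it, and that term shrinks.\<close>
      have t1: "t 1 > 0" "t 1 \<le> \<tau>"
        using t_ge[of 1] mono_onD[OF t_mono, of 1 "k + 1"] by (auto simp: \<tau>_def)
      then have "(t 1)\<^sup>2 \<le> \<tau>\<^sup>2" by (intro power_mono) auto
      then have "(t 1)\<^sup>2 * (\<beta> * Lg2) \<le> \<tau>\<^sup>2 * (\<beta> * Lg2)"
        using params Lg0 by (intro mult_right_mono) auto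
      moreover have "\<tau>\<^sup>2 * (\<beta> * (Lg2 + (t 1)\<^sup>2 * \<gamma> * (matrix_opnorm B)\<^sup>2)) \<le> \<tau>\<^sup>2 * (t 1)\<^sup>2"
        by (rule mult_left_mono[OF Lg_bound]) simp
      ultimately have "(t 1)\<^sup>2 * (\<beta> * (Lg2 + \<gamma> * \<tau>\<^sup>2 * (matrix_opnorm B)\<^sup>2)) \<le> (t 1)\<^sup>2 * \<tau>\<^sup>2"
        by (simp add: algebra_simps)
      then have "\<beta> * (Lg2 + \<gamma> * \<tau>\<^sup>2 * (matrix_opnorm B)\<^sup>2) \<le> \<tau>\<^sup>2"
        using t1 by (simp add: mult_le_cancel_left_pos)
      then show ?thesis using params by (simp add: field_simps)
    qed
    have v_coeff': "(Lg2 / 2 + \<gamma> * \<tau>\<^sup>2 / 2 * (matrix_opnorm B)\<^sup>2) * (norm (v (k + 1) - v k))\<^sup>2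
        \<le> \<tau>\<^sup>2 / (2 * \<beta>) * (norm (v (k + 1) - v k))\<^sup>2"
      by (rule mult_right_mono[OF v_coeff]) simp
    have u_coeff: "Lf2 / 2 * (norm (u (k + 1) - u k))\<^sup>2 \<le> 1 / (2 * \<alpha>) * (norm (u (k + 1) - u k))\<^sup>2"
      using Lf_bound params by (intro mult_right_mono) (auto simp: field_simps)
    \<comment> \<open>This is \<open>t_step2\<close> at index \<open>k + 1\<close>, divided by
      \<open>2 * \<beta>\<close>; the term with \<open>\<mu>g\<close> is the gain in
      \<open>g_step\<close>.\<close>
    have next_coeff: "(t (k + 2))\<^sup>2 / (2 * \<beta>) * (norm (v (k + 1) - ys))\<^sup>2
        \<le> (\<tau>\<^sup>2 / (2 * \<beta>) + \<tau> * \<mu>g / 2) * (norm (v (k + 1) - ys))\<^sup>2"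
      using t_step2[of "k + 1"] params
      by (intro mult_right_mono) (auto simp: \<tau>_def field_simps)
    have D0: "D k \<ge> 0"
      using sad2[of "x k" "y k"] xk yk dom_s feas by (simp add: L_real D_def)
    \<comment> \<open>The saddle inequality makes \<open>D k\<close> nonnegative, so the comparison
      of weights in \<open>t_step1\<close> survives multiplication by it.\<close>
    have D_coeff: "(\<tau>\<^sup>2 - \<tau>) * D k \<le> (t k)\<^sup>2 * D k"
      using t_step1[OF k] D0 by (intro mult_right_mono) (auto simp: \<tau>_def)

    \<comment> \<open>Assembly of the energy inequality\<close>
    have D': "\<tau>\<^sup>2 * D (k + 1) = \<tau>\<^sup>2 * (F (x (k + 1)) - F xs) + \<tau>\<^sup>2 * (G (y (k + 1)) - G ys)
        + (\<tau>\<^sup>2 - \<tau>) * (ls \<bullet> r (x k) (y k)) + \<tau> * (ls \<bullet> w)"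
      using arg_cong[OF res, of "\<lambda>z. ls \<bullet> z"]
      by (simp add: D_def inner_add_right algebra_simps)
    have f_step': "\<tau>\<^sup>2 * (F (x (k + 1)) - F xs) \<le> (\<tau>\<^sup>2 - \<tau>) * (F (x k) - F xs)
          + \<tau> * ((transpose A *v lbar) \<bullet> (xs - u (k + 1)))
          + 1 / (2 * \<alpha>) * (norm (u k - xs))\<^sup>2 - 1 / (2 * \<alpha>) * (norm (u (k + 1) - xs))\<^sup>2"
      using f_step(2) u_coeff \<tau>0 by (simp add: algebra_simps diff_divide_distrib)
    have g_step': "\<tau>\<^sup>2 * (G (y (k + 1)) - G ys) \<le> (\<tau>\<^sup>2 - \<tau>) * (G (y k) - G ys)
          + \<tau> * ((transpose B *v lbar) \<bullet> (ys - v (k + 1)))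
          + \<tau>\<^sup>2 / (2 * \<beta>) * (norm (v k - ys))\<^sup>2
          - (t (k + 2))\<^sup>2 / (2 * \<beta>) * (norm (v (k + 1) - ys))\<^sup>2
          - \<gamma> * \<tau>\<^sup>2 / 2 * ((matrix_opnorm B)\<^sup>2 * (norm (v (k + 1) - v k))\<^sup>2)"
    proof -
      have "\<tau> * (\<tau> / \<beta>) / 2 = \<tau>\<^sup>2 / (2 * \<beta>)" by (simp add: power2_eq_square)
      from g_step(2)[unfolded this] show ?thesis
        using v_coeff' next_coeff by (simp add: algebra_simps)
    qed
    have coup': "\<tau> * ((transpose A *v lbar) \<bullet> (xs - u (k + 1)))
        + \<tau> * ((transpose B *v lbar) \<bullet> (ys - v (k + 1))) = - \<tau> * (lbar \<bullet> w)"
      using coupling by (simp flip: distrib_left)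
    have "\<tau>\<^sup>2 * D (k + 1) \<le> (\<tau>\<^sup>2 - \<tau>) * D k + \<tau> * ((ls - lbar) \<bullet> w)
          + 1 / (2 * \<alpha>) * (norm (u k - xs))\<^sup>2 - 1 / (2 * \<alpha>) * (norm (u (k + 1) - xs))\<^sup>2
          + \<tau>\<^sup>2 / (2 * \<beta>) * (norm (v k - ys))\<^sup>2
          - (t (k + 2))\<^sup>2 / (2 * \<beta>) * (norm (v (k + 1) - ys))\<^sup>2
          - \<gamma> * \<tau>\<^sup>2 / 2 * ((matrix_opnorm B)\<^sup>2 * (norm (v (k + 1) - v k))\<^sup>2)"
    proof -
      have "(\<tau>\<^sup>2 - \<tau>) * D k = (\<tau>\<^sup>2 - \<tau>) * (F (x k) - F xs) + (\<tau>\<^sup>2 - \<tau>) * (G (y k) - G ys)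
          + (\<tau>\<^sup>2 - \<tau>) * (ls \<bullet> r (x k) (y k))"
        by (simp add: D_def algebra_simps)
      moreover have "\<tau> * ((ls - lbar) \<bullet> w) = \<tau> * (ls \<bullet> w) - \<tau> * (lbar \<bullet> w)"
        by (simp add: inner_diff_left algebra_simps)
      ultimately show ?thesis using f_step' g_step' coup' D' by linarith
    qed
    then have "E (k + 1) \<le> E k"
      using dual e_bound D_coeff unfolding E_def
      by (simp add: diff_divide_distrib \<tau>_def)
    \<comment> \<open>Through \<open>res\<close> the multiplier increment involves only residuals of
      the averaged iterates, the form that telescopes later.\<close>
    moreover have "\<Lambda> (k + 1) = \<Lambda> k + \<gamma> *\<^sub>R (\<tau>\<^sup>2 *\<^sub>R r (x (k + 1)) (y (k + 1))
            - (\<tau>\<^sup>2 - \<tau>) *\<^sub>R r (x k) (y k))"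
      unfolding res \<Lambda>' by (simp add: w_def)
    ultimately show ?thesis using f_step(1) g_step(1) by (simp add: \<tau>_def)
  qed

  \<comment> \<open>Invariants along the iteration\<close>
  have inv: "x k \<in> edom f1 \<and> y k \<in> edom g1 \<and> E k \<le> E 1
      \<and> u k = t k *\<^sub>R x k - (t k - 1) *\<^sub>R x (k - 1)
      \<and> v k = t k *\<^sub>R y k - (t k - 1) *\<^sub>R y (k - 1)" if "k \<ge> 1" for k
    using that
  proof (induction k rule: dec_induct)
    case base
    \<comment> \<open>As \<open>x 0 = x 1\<close>, the coefficients \<open>t 1\<close> and
      \<open>t 1 - 1\<close> leave exactly \<open>x 1 = u 1\<close>; likewise for \<open>y\<close>
      and \<open>v\<close>.\<close>
    then show ?case using init by (simp add: algebra_simps)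
  next
    case (step k)
    have tk: "t (k + 1) > 0" using \<tau>pos by simp
    have "x (k + 1) = (1 / t (k + 1)) *\<^sub>R u (k + 1) + ((t (k + 1) - 1) / t (k + 1)) *\<^sub>R x k"
      "y (k + 1) = (1 / t (k + 1)) *\<^sub>R v (k + 1) + ((t (k + 1) - 1) / t (k + 1)) *\<^sub>R y k"
      using it step.hyps by blast+
    \<comment> \<open>Solving the averaging updates for \<open>u\<close> and \<open>v\<close>
      restores the representation that \<open>energy_step\<close> presupposes.\<close>
    then have "t (k + 1) *\<^sub>R x (k + 1) = u (k + 1) + (t (k + 1) - 1) *\<^sub>R x k"
      "t (k + 1) *\<^sub>R y (k + 1) = v (k + 1) + (t (k + 1) - 1) *\<^sub>R y k"
      using tk by (simp_all add: scaleR_add_right)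
    then show ?case
      using energy_step[of k] step by auto
  qed

  \<comment> \<open>Bounds on the Lagrangian gap and the multipliers\<close>
  have E_1: "E 1 = E1"
    using init dom_s feas by (simp add: E_def E1_def L_real D_def numeral_2_eq_2)
  have D0: "D k \<ge> 0" if "k \<ge> 1" for k
    using sad2[of "x k" "y k"] inv[OF that] dom_s feas by (simp add: L_real D_def)
  have D_bound: "D k \<le> E1 / (t k)\<^sup>2" if "k \<ge> 1" for k
  proof -
    have "(t k)\<^sup>2 * D k \<le> E k"
      using params by (auto simp: E_def)
    then have "(t k)\<^sup>2 * D k \<le> E1" using inv[OF that] E_1 by simp
    then show ?thesis using \<tau>pos[OF that] by (simp add: field_simps)
  qed
  have \<Lambda>_bound: "norm (\<Lambda> k - ls) \<le> sqrt (2 * \<gamma> * E1)" if "k \<ge> 1" for k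
  proof -
    have "1 / (2 * \<gamma>) * (norm (\<Lambda> k - ls))\<^sup>2 \<le> E k"
      using params D0[OF that] by (simp add: E_def)
    also have "\<dots> \<le> E1" using inv[OF that] E_1 by simp
    finally have "(norm (\<Lambda> k - ls))\<^sup>2 \<le> 2 * \<gamma> * E1"
      using params by (simp add: field_simps)
    then show ?thesis by (simp add: real_le_rsqrt)
  qed

  \<comment> \<open>Bound on the constraint residual\<close>
  define s where "s k = (t k)\<^sup>2 *\<^sub>R r (x k) (y k)" for k
  \<comment> \<open>Chosen so that
    \<open>(1 - c k) * (t k)\<^sup>2 = (t (k + 1))\<^sup>2 - t (k + 1)\<close>. The multiplier
    increment over \<open>\<gamma>\<close> is then \<open>s (k + 1) - s k\<close> plus
    \<open>c k\<close> times \<open>s k\<close>.\<close>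
  define c where "c k = ((t k)\<^sup>2 - (t (k + 1))\<^sup>2 + t (k + 1)) / (t k)\<^sup>2" for k
  have telescope: "s k + (\<Sum>j=1..<k. c j *\<^sub>R s j) = s 1 + (1 / \<gamma>) *\<^sub>R (\<Lambda> k - \<Lambda> 1)"
    if "k \<ge> 1" for k
    using that
  proof (induction k rule: dec_induct)
    case base
    then show ?case by simp
  next
    case (step k)
    have cs: "c k *\<^sub>R s k = ((t k)\<^sup>2 - (t (k + 1))\<^sup>2 + t (k + 1)) *\<^sub>R r (x k) (y k)"
      using \<tau>pos[of k] step.hyps by (simp add: c_def s_def)
    have "\<Lambda> (k + 1) = \<Lambda> k + \<gamma> *\<^sub>R ((t (k + 1))\<^sup>2 *\<^sub>R r (x (k + 1)) (y (k + 1))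
            - ((t (k + 1))\<^sup>2 - t (k + 1)) *\<^sub>R r (x k) (y k))"
      using energy_step[of k] inv[of k] step.hyps by blast
    then have "(1 / \<gamma>) *\<^sub>R (\<Lambda> (k + 1) - \<Lambda> k) = (t (k + 1))\<^sup>2 *\<^sub>R r (x (k + 1)) (y (k + 1))
            - ((t (k + 1))\<^sup>2 - t (k + 1)) *\<^sub>R r (x k) (y k)"
      using params by simp
    then have "s (k + 1) - s k + c k *\<^sub>R s k = (1 / \<gamma>) *\<^sub>R (\<Lambda> (k + 1) - \<Lambda> k)"
      unfolding cs by (simp add: s_def algebra_simps)
    then have "s (k + 1) + c k *\<^sub>R s k = s k + (1 / \<gamma>) *\<^sub>R (\<Lambda> (k + 1) - \<Lambda> k)"
      by (simp add: algebra_simps)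
    then have "s (k + 1) + (\<Sum>j=1..<k + 1. c j *\<^sub>R s j)
        = (s k + (\<Sum>j=1..<k. c j *\<^sub>R s j)) + (1 / \<gamma>) *\<^sub>R (\<Lambda> (k + 1) - \<Lambda> k)"
      using step.hyps by (simp add: algebra_simps)
    also have "\<dots> = s 1 + (1 / \<gamma>) *\<^sub>R (\<Lambda> (k + 1) - \<Lambda> 1)"
      unfolding step.IH by (simp add: algebra_simps)
    finally show ?case by simp
  qed
  \<comment> \<open>Bounds the right side of \<open>telescope\<close>; the distance from
    \<open>\<Lambda> 1\<close> to \<open>\<Lambda> k\<close> is measured through
    \<open>ls\<close>.\<close>
  define M where "M = norm (s 1) + (norm (\<Lambda> 1 - ls) + sqrt (2 * \<gamma> * E1)) / \<gamma>"
  have "norm (s k) \<le> 2 * M" if k: "k \<ge> 1" for k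
  proof (rule norm_le_of_weighted_partial_sums[of c, OF _ _ _ k])
    fix j :: nat assume j: "j \<ge> 1"
    have tj: "t j \<ge> 1" "t (j + 1) \<ge> 1" using t_ge j by auto
    then show "0 \<le> c j"
      using t_step1[OF j] by (simp add: c_def)
    have "t (j + 1) \<le> (t (j + 1))\<^sup>2"
      using tj by (simp add: power2_eq_square)
    then show "c j \<le> 1" using tj by (simp add: c_def)
    have "norm (\<Lambda> j - \<Lambda> 1) \<le> norm (\<Lambda> 1 - ls) + sqrt (2 * \<gamma> * E1)"
      using \<Lambda>_bound[OF j] norm_triangle_ineq4[of "\<Lambda> j - ls" "\<Lambda> 1 - ls"] by simp
    then have "norm ((1 / \<gamma>) *\<^sub>R (\<Lambda> j - \<Lambda> 1)) \<le> (norm (\<Lambda> 1 - ls) + sqrt (2 * \<gamma> * E1)) / \<gamma>"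
      using params by (simp add: divide_right_mono)
    then show "norm (s j + (\<Sum>i=1..<j. c i *\<^sub>R s i)) \<le> M"
      unfolding telescope[OF j] M_def by (intro norm_triangle_le add_left_mono)
  qed
  \<comment> \<open>Doubling \<open>M\<close> gives the initial residual the coefficient 2, below
    the 3 in \<open>C2\<close>; the other terms agree.\<close>
  moreover have "2 * M \<le> C2"
    by (simp add: M_def C2_def s_def r_def add_divide_distrib)
  ultimately have r_bound: "norm (r (x k) (y k)) \<le> C2 / (t k)\<^sup>2" if "k \<ge> 1" for k
    using that \<tau>pos[OF that] by (force simp: s_def field_simps)

  \<comment> \<open>The three estimates\<close>
  show ?thesis
  proof (intro allI impI conjI)
    fix k :: nat assume k: "k \<ge> 1"
    have dom: "x k \<in> edom f1" "y k \<in> edom g1" using inv[OF k] by auto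
    show "L (x k) (y k) ls - L xs ys ls \<le> ereal (E1 / (t k)\<^sup>2)"
      using D_bound[OF k] dom dom_s feas by (simp add: L_real D_def)
    show "norm (A *v x k + B *v y k - b) \<le> C2 / (t k)\<^sup>2"
      using r_bound[OF k] by (simp add: r_def)
    \<comment> \<open>The objective gap is \<open>D k\<close> minus this product; \<open>D k\<close>
      lies between 0 and its bound, and Cauchy-Schwarz handles the product.\<close>
    have "\<bar>ls \<bullet> r (x k) (y k)\<bar> \<le> norm ls * norm (r (x k) (y k))"
      by (rule Cauchy_Schwarz_ineq2)
    also have "\<dots> \<le> norm ls * (C2 / (t k)\<^sup>2)"
      using r_bound[OF k] by (rule mult_left_mono) simp
    finally have "\<bar>ls \<bullet> r (x k) (y k)\<bar> \<le> C2 * norm ls / (t k)\<^sup>2"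
      by (simp add: mult.commute)
    then have "\<bar>F (x k) + G (y k) - F xs - G ys\<bar> \<le> (E1 + C2 * norm ls) / (t k)\<^sup>2"
      using D0[OF k] D_bound[OF k] by (simp add: D_def add_divide_distrib)
    then show "\<bar>f (x k) + g (y k) - f xs - g ys\<bar> \<le> ereal ((E1 + C2 * norm ls) / (t k)\<^sup>2)"
      using dom dom_s by (simp add: f_real g_real)
  qed
qed

end
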